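(* If $n$ is even but not a power of $2$, then there is a transitive permutation group $G$ of degree $n$ such that $\Gamma_G$ is a complete multipartite graph with $n/2$ parts.
   Context: For a permutation group $K$ on a finite set, an element is a derangement if it fixes no point. The derangement graph $\Gamma_K$ is the graph with vertex set $K$ in which distinct $g,h$ are adjacent iff $gh^{-1}$ is a derangement. *)

theory Defs
  imports
    "HOL-Algebra.Sym_Groups"
    "HOL-Algebra.Group_Action"
    "HOL-Library.Disjoint_Sets"
    "Graph_Theory.Graph_Theory"
begin

text \<open>
  A permutation group of degree \<open>n\<close> is a subgroup \<open>K\<close> of \<^const>\<open>sym_group\<close> \<open>n\<close>, whose elements are
  functions on all of \<^typ>\<open>nat\<close> that fix every point outside \<open>{1..n}\<close>. Library actions take values
  in \<^const>\<open>BijGroup\<close>, whose elements are extensional functions, so the natural action of \<open>K\<close> sends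
  a permutation to its restriction to \<open>{1..n}\<close>.
\<close>

definition transitive_perm_group :: "nat \<Rightarrow> (nat \<Rightarrow> nat) set \<Rightarrow> bool" where
  "transitive_perm_group n K \<longleftrightarrow>
     subgroup K (sym_group n) \<and>
     transitive_action (sym_group n\<lparr>carrier := K\<rparr>) {1..n} (\<lambda>g. restrict g {1..n})"

definition derangement :: "nat \<Rightarrow> (nat \<Rightarrow> nat) \<Rightarrow> bool" where
  "derangement n g \<longleftrightarrow> (\<forall>x\<in>{1..n}. g x \<noteq> x)"

text \<open>Undirected graphs are represented as symmetric digraphs.\<close>

definition derangement_graph :: "nat \<Rightarrow> (nat \<Rightarrow> nat) set \<Rightarrow> (nat \<Rightarrow> nat) pair_pre_digraph" where
  "derangement_graph n K =
     \<lparr>pverts = K,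
      parcs = {(g, h). g \<in> K \<and> h \<in> K \<and> g \<noteq> h \<and>
                       derangement n (g \<otimes>\<^bsub>sym_group n\<^esub> inv\<^bsub>sym_group n\<^esub> h)}\<rparr>"

text \<open>The parts are the blocks of a partition; in particular they are nonempty.\<close>

definition complete_multipartite_digraph :: "nat \<Rightarrow> ('a, 'b) pre_digraph \<Rightarrow> bool" where
  "complete_multipartite_digraph k G \<longleftrightarrow>
     graph G \<and>
     (\<exists>P. partition_on (verts G) P \<and> card P = k \<and>
          arcs_ends G = {(u, v). u \<in> verts G \<and> v \<in> verts G \<and> \<not> (\<exists>A\<in>P. u \<in> A \<and> v \<in> A)})"

lemma transitive_perm_group_iff:
  "transitive_perm_group n K \<longleftrightarrow>
     subgroup K (sym_group n) \<and> (\<forall>x\<in>{1..n}. \<forall>y\<in>{1..n}. \<exists>g\<in>K. g x = y)"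
proof (cases "subgroup K (sym_group n)")
  case True
  let ?G = "sym_group n\<lparr>carrier := K\<rparr>" and ?f = "\<lambda>g. restrict g {1..n}"
  have perm: "g permutes {1..n}" if "g \<in> K" for g
    using subgroup.subset[OF True] that by (auto simp: sym_group_def)
  have bij: "?f g \<in> Bij {1..n}" if "g \<in> K" for g
    using permutes_imp_bij[OF perm[OF that]] bij_betw_cong[of "{1..n}" "?f g" g "{1..n}"]
    by (simp add: Bij_def)
  have "group ?G"
    by (rule group.subgroup_imp_group[OF sym_group_is_group True])
  moreover have "?f \<in> hom ?G (BijGroup {1..n})"
  proof (rule homI)
    fix g assume "g \<in> carrier ?G"
    then show "?f g \<in> carrier (BijGroup {1..n})" using bij by (simp add: BijGroup_def)
  next
    fix g h assume gh: "g \<in> carrier ?G" "h \<in> carrier ?G"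
    have "h x \<in> {1..n}" if "x \<in> {1..n}" for x
      using permutes_in_image[OF perm, of h x] gh that by simp
    then have "?f (g \<circ> h) = compose {1..n} (?f g) (?f h)"
      by (auto simp: compose_def fun_eq_iff restrict_def)
    then show "?f (g \<otimes>\<^bsub>?G\<^esub> h) = ?f g \<otimes>\<^bsub>BijGroup {1..n}\<^esub> ?f h"
      using gh bij by (simp add: BijGroup_def sym_group_def)
  qed
  ultimately have "group_action ?G {1..n} ?f"
    by (simp add: group_action_def group_hom_def group_hom_axioms_def group_BijGroup)
  then show ?thesis
    using True
    by (auto simp: transitive_perm_group_def transitive_action_def transitive_action_axioms_def)
qed (simp add: transitive_perm_group_def)

end

theory Submission
  imports Defs "HOL-Computational_Algebra.Primes"
begin

text \<open>
  Write \<open>n = 2 m\<close> and let \<open>q > 1\<close> be an odd divisor of \<open>m\<close>. The points are arranged in \<open>m\<close> blocks of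
  size two, indexed by the integers modulo \<open>m\<close>. The group \<open>G\<close> consists of the maps
  \<open>(b, e) \<mapsto> (b + r, e + f b)\<close>, where \<open>f\<close> is a function into the integers modulo 2 whose
  sum over any \<open>q\<close> consecutive arguments vanishes. As \<open>q\<close> is odd, such an \<open>f\<close> cannot be constantly
  1, so every element of \<open>G\<close> with \<open>r = 0\<close> has a fixed point, whereas no element with
  \<open>r \<noteq> 0\<close> has one. Hence two elements are adjacent in the derangement graph iff their rotation
  parts \<open>r\<close> differ, and the \<open>m\<close> values of \<open>r\<close> give the parts.
\<close>

section \<open>Derangement graphs and agreement of permutations\<close>

text \<open>A fixed point \<open>y\<close> of the product of \<open>g\<close> with the inverse of
  \<open>h\<close> is the image under \<open>h\<close> of a point where \<open>g\<close> and
  \<open>h\<close> agree.\<close>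

lemma derangement_mult_inv_iff:
  assumes "g permutes {1..n}" "h permutes {1..n}"
  shows "derangement n (g \<otimes>\<^bsub>sym_group n\<^esub> inv\<^bsub>sym_group n\<^esub> h) \<longleftrightarrow> (\<forall>x\<in>{1..n}. g x \<noteq> h x)"
proof -
  have inv: "inv\<^bsub>sym_group n\<^esub> h = Hilbert_Choice.inv h"
    using assms(2) by (simp add: sym_group_carrier)
  have "(\<forall>y\<in>h ` {1..n}. g (Hilbert_Choice.inv h y) \<noteq> y) \<longleftrightarrow> (\<forall>x\<in>{1..n}. g x \<noteq> h x)"
    using permutes_inverses(2)[OF assms(2)] by simp
  then show ?thesis
    unfolding derangement_def inv sym_group_mult permutes_image[OF assms(2)] by simp
qed

text \<open>Agreeing somewhere is non-adjacency. If it amounts to equality of an invariant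
  \<open>\<rho>\<close>, it is an equivalence relation, and the fibres of \<open>\<rho>\<close> are
  the parts.\<close>

lemma complete_multipartite_derangement_graphI:
  fixes \<rho> :: "(nat \<Rightarrow> nat) \<Rightarrow> 'i"
  assumes perm: "\<And>g. g \<in> K \<Longrightarrow> g permutes {1..n}"
    and agree: "\<And>g h. g \<in> K \<Longrightarrow> h \<in> K \<Longrightarrow> (\<exists>x\<in>{1..n}. g x = h x) \<longleftrightarrow> \<rho> g = \<rho> h"
  shows "complete_multipartite_digraph (card (\<rho> ` K)) (with_proj (derangement_graph n K))"
proof -
  let ?D = "derangement_graph n K"
  have verts: "pverts ?D = K"
    by (simp add: derangement_graph_def)
  have arcs: "parcs ?D = {(g, h). g \<in> K \<and> h \<in> K \<and> \<rho> g \<noteq> \<rho> h}"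
  proof -
    have "g \<noteq> h \<and> derangement n (g \<otimes>\<^bsub>sym_group n\<^esub> inv\<^bsub>sym_group n\<^esub> h) \<longleftrightarrow> \<rho> g \<noteq> \<rho> h"
      if "g \<in> K" "h \<in> K" for g h
      using agree[OF that] derangement_mult_inv_iff[OF perm[OF that(1)] perm[OF that(2)]] by blast
    then show ?thesis
      unfolding derangement_graph_def by auto
  qed
  have "finite {g. g permutes {1..n}}"
    by (rule finite_permutations) simp
  then have fin: "finite K"
    by (rule finite_subset[rotated]) (use perm in auto)
  have "parcs ?D \<subseteq> K \<times> K"
    using arcs by auto
  then have "finite (parcs ?D)"
    by (rule finite_subset) (simp add: fin)
  then have "pair_graph ?D"
    by unfold_locales (auto simp: verts arcs fin symmetric_def sym_def)
  then have graph: "graph (with_proj ?D)"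
    by (rule pair_graph.pair_graphD_graph)
  define fib where "fib = (\<lambda>i. {g \<in> K. \<rho> g = i})"
  let ?P = "fib ` \<rho> ` K"
  have "partition_on K ?P"
    by (rule partition_onI) (auto simp: fib_def disjnt_def)
  moreover have "inj_on fib (\<rho> ` K)"
    by (auto simp: inj_on_def fib_def)
  then have "card ?P = card (\<rho> ` K)"
    by (rule card_image)
  moreover have "parcs ?D = {(u, v). u \<in> K \<and> v \<in> K \<and> \<not> (\<exists>A\<in>?P. u \<in> A \<and> v \<in> A)}"
    unfolding arcs by (auto simp: fib_def)
  ultimately show ?thesis
    using graph by (auto simp: complete_multipartite_digraph_def verts)
qed

section \<open>Points, twists and the group\<close>

locale twisted_rotations =
  fixes m q :: nat
  assumes m_pos: "m > 0" and q_odd: "odd q" and q_gt_1: "q > 1" and q_dvd_m: "q dvd m"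
begin

text \<open>Coordinates are arbitrary integers reduced only here, so that they can be added
  freely.\<close>

definition point :: "int \<Rightarrow> int \<Rightarrow> nat" where
  "point b e = nat (2 * (b mod int m) + e mod 2 + 1)"

text \<open>Values are integers of which only the parity matters. Periodicity modulo
  \<open>m\<close> is not imposed; up to parity it follows from the window condition.\<close>

definition twists :: "(int \<Rightarrow> int) set" where
  "twists = {f. \<forall>b. even (\<Sum>i<q. f (b + int i))}"

text \<open>A relation, since \<open>g\<close> determines \<open>r\<close> only modulo
  \<open>m\<close> and the values of \<open>f\<close> only modulo 2.\<close>

definition acts_by :: "(nat \<Rightarrow> nat) \<Rightarrow> int \<Rightarrow> (int \<Rightarrow> int) \<Rightarrow> bool" where
  "acts_by g r f \<longleftrightarrow> (\<forall>b e. g (point b e) = point (b + r) (e + f b))"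

definition rotation_group :: "(nat \<Rightarrow> nat) set" where
  "rotation_group = {g. g permutes {1..2 * m} \<and> (\<exists>r. \<exists>f\<in>twists. acts_by g r f)}"

lemma point_eq_iff:
  "point b e = point b' e' \<longleftrightarrow> b mod int m = b' mod int m \<and> e mod 2 = e' mod 2"
proof -
  have "nat (2 * c + d + 1) = nat (2 * c' + d' + 1) \<longleftrightarrow> c = c' \<and> d = d'"
    if "c \<ge> 0" "c' \<ge> 0" "d \<in> {0..<2}" "d' \<in> {0..<2}" for c c' d d' :: int
    using that by (simp add: eq_nat_nat_iff) presburger
  then show ?thesis
    unfolding point_def using m_pos by simp
qed

lemma point_in: "point b e \<in> {1..2 * m}"
proof -
  have "nat (2 * c + d + 1) \<in> {1..2 * m}" if "0 \<le> c" "c < int m" "d \<in> {0..<2}" for c d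
    using that by auto
  then show ?thesis
    unfolding point_def using m_pos by simp
qed

lemma pointE:
  assumes "x \<in> {1..2 * m}"
  obtains b e where "x = point b e"
proof -
  let ?b = "(int x - 1) div 2"
  have "0 \<le> ?b" "?b < int m"
    using assms by auto
  then have "?b mod int m = ?b"
    by (rule mod_pos_pos_trivial)
  moreover have "int x = 2 * ?b + (int x - 1) mod 2 + 1"
    by presburger
  ultimately have "x = point ?b (int x - 1)"
    unfolding point_def by linarith
  then show thesis
    by (rule that)
qed

lemma twists_zero: "(\<lambda>_. 0) \<in> twists"
  by (simp add: twists_def)

lemma twists_add: "f \<in> twists \<Longrightarrow> k \<in> twists \<Longrightarrow> (\<lambda>b. f b + k b) \<in> twists"
  by (simp add: twists_def sum.distrib)

lemma twists_uminus: "f \<in> twists \<Longrightarrow> (\<lambda>b. - f b) \<in> twists"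
  by (simp add: twists_def sum_negf)

lemma twists_shift:
  assumes "f \<in> twists"
  shows "(\<lambda>b. f (b + r)) \<in> twists"
proof -
  have "(\<Sum>i<q. f (b + int i + r)) = (\<Sum>i<q. f (b + r + int i))" for b
    by (simp add: algebra_simps)
  then show ?thesis
    using assms by (simp add: twists_def)
qed

text \<open>Windows starting at \<open>b\<close> and \<open>b + 1\<close> differ only in their end
  terms, so \<open>f\<close> has period \<open>q\<close> up to parity, hence also period
  \<open>m\<close>. This makes the action on points well defined.\<close>

lemma twists_cong:
  assumes f: "f \<in> twists" and bb': "b mod int m = b' mod int m"
  shows "f b mod 2 = f b' mod 2"
proof -
  have step: "f (b + int q) mod 2 = f b mod 2" for b
  proof -
    \<comment> \<open>The \<open>q + 1\<close> values from \<open>b\<close> to \<open>b + q\<close>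
      are summed once with the first and once with the last term split off.\<close>
    have "f b + (\<Sum>i<q. f (b + 1 + int i)) = (\<Sum>i<Suc q. f (b + int i))"
      unfolding sum.lessThan_Suc_shift by (simp add: algebra_simps)
    then have "f b + (\<Sum>i<q. f (b + 1 + int i)) = (\<Sum>i<q. f (b + int i)) + f (b + int q)"
      by simp
    moreover have "even (\<Sum>i<q. f (b + 1 + int i))" "even (\<Sum>i<q. f (b + int i))"
      using f unfolding twists_def by blast+
    ultimately show ?thesis
      by presburger
  qed
  have steps: "f (b + int q * int k) mod 2 = f b mod 2" for b k
  proof (induction k)
    case (Suc k)
    have "f (b + int q * int (Suc k)) = f ((b + int q * int k) + int q)"
      by (simp add: algebra_simps)
    then show ?case
      using Suc step by simp
  qed simp
  have le: "f b mod 2 = f b' mod 2" if "b mod int m = b' mod int m" "b \<le> b'" for b b'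
  proof -
    have "int m dvd b' - b"
      using that(1) by (metis mod_eq_dvd_iff)
    then have "int q dvd b' - b"
      using q_dvd_m by (meson dvd_trans of_nat_dvd_iff)
    then obtain c where c: "b' - b = int q * c" ..
    then have "0 \<le> int q * c"
      using that(2) by linarith
    then have "c \<ge> 0"
      using q_gt_1 by (simp add: zero_le_mult_iff)
    then have "b' = b + int q * int (nat c)"
      using c by simp
    then show ?thesis
      using steps by metis
  qed
  then show ?thesis
    using bb' by (metis linear)
qed

text \<open>An odd number of odd values has an odd sum, against the window condition.\<close>

lemma twists_even_value:
  assumes "f \<in> twists"
  obtains b where "even (f b)"
proof -
  have "\<exists>b. even (f b)"
  proof (rule ccontr)
    assume "\<nexists>b. even (f b)"
    then have "odd (\<Sum>i<q. f (0 + int i))"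
      using q_odd by (simp add: even_sum_iff)
    then show False
      using assms unfolding twists_def by blast
  qed
  then show thesis
    using that by blast
qed

text \<open>The function \<open>k\<close> times the increment of a \<open>q\<close>-periodic indicator sums to 0 over each window.\<close>

lemma twists_exists_value:
  obtains f where "f \<in> twists" "f b = k"
proof -
  define u where "u = (\<lambda>c. if int q dvd c - b then k else 0)"
  define f where "f = (\<lambda>c. u c - u (c - 1))"
  \<comment> \<open>The sum telescopes; for \<open>j = q\<close> its two end terms cancel by
    periodicity of \<open>u\<close>.\<close>
  have "(\<Sum>i<j. f (c + int i)) = u (c + int j - 1) - u (c - 1)" for c j
  proof (induction j)
    case (Suc j)
    have "c + int (Suc j) - 1 = c + int j"
      by simp
    with Suc show ?case
      by (simp add: f_def)
  qed simp
  moreover have "u (c + int q - 1) = u (c - 1)" for c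
  proof -
    have "c + int q - 1 - b = (c - 1 - b) + int q"
      by simp
    then show ?thesis
      unfolding u_def by (metis dvd_add_left_iff dvd_refl)
  qed
  ultimately have "f \<in> twists"
    by (simp add: twists_def)
  \<comment> \<open>As \<open>q > 1\<close>, it does not divide -1, so \<open>u (b - 1)\<close> is
    0.\<close>
  moreover have "f b = k"
    using q_gt_1 by (simp add: f_def u_def)
  ultimately show thesis
    by (rule that)
qed

section \<open>Existence of the maps, group laws and transitivity\<close>

text \<open>The summands \<open>b\<close> and \<open>e\<close> cancel, so two such maps agree on
  both points of a block or on neither.\<close>

lemma acts_by_eq_iff:
  assumes "acts_by g r f" "acts_by h s k"
  shows "g (point b e) = h (point b e) \<longleftrightarrow> r mod int m = s mod int m \<and> even (f b - k b)"
proof -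
  have "(b + r) mod int m = (b + s) mod int m \<longleftrightarrow> r mod int m = s mod int m"
    by (simp add: mod_eq_dvd_iff)
  moreover have "(e + f b) mod 2 = (e + k b) mod 2 \<longleftrightarrow> even (f b - k b)"
    by presburger
  ultimately show ?thesis
    using assms by (simp add: acts_by_def point_eq_iff)
qed

lemma acts_by_exists:
  assumes f: "f \<in> twists"
  obtains g where "g permutes {1..2 * m}" "acts_by g r f"
proof -
  \<comment> \<open>Any choice of coordinates will do: by \<open>twists_cong\<close> the image does
    not depend on it.\<close>
  define p where "p = (\<lambda>x. SOME p. x = point (fst p) (snd p))"
  define g where "g = (\<lambda>x. if x \<in> {1..2 * m}
    then point (fst (p x) + r) (snd (p x) + f (fst (p x))) else x)"
  have g: "g (point b e) = point (b + r) (e + f b)" for b e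
  proof -
    obtain b' e' where p: "p (point b e) = (b', e')"
      by fastforce
    have "point b e = point (fst (p (point b e))) (snd (p (point b e)))"
      unfolding p_def by (rule someI[of _ "(b, e)"]) simp
    then have eq: "b' mod int m = b mod int m" "e' mod 2 = e mod 2"
      by (simp_all add: p point_eq_iff)
    then have "f b' mod 2 = f b mod 2"
      using twists_cong[OF f] by blast
    then have "(e' + f b') mod 2 = (e + f b) mod 2"
      using eq(2) by (metis mod_add_eq)
    moreover have "(b' + r) mod int m = (b + r) mod int m"
      using eq(1) by (metis mod_add_left_eq)
    ultimately show ?thesis
      using point_in by (simp add: g_def p point_eq_iff)
  qed
  have inj: "inj_on g {1..2 * m}"
  proof (rule inj_onI)
    fix x y assume xy: "x \<in> {1..2 * m}" "y \<in> {1..2 * m}" and "g x = g y"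
    obtain b e where x: "x = point b e"
      using xy(1) by (rule pointE)
    obtain b' e' where y: "y = point b' e'"
      using xy(2) by (rule pointE)
    have "(b + r) mod int m = (b' + r) mod int m" and ef: "(e + f b) mod 2 = (e' + f b') mod 2"
      using \<open>g x = g y\<close> by (simp_all add: x y g point_eq_iff)
    then have b: "b mod int m = b' mod int m"
      by (simp add: mod_eq_dvd_iff)
    then have "f b mod 2 = f b' mod 2"
      by (rule twists_cong[OF f])
    then have "e mod 2 = e' mod 2"
      using ef by presburger
    with b show "x = y"
      by (simp add: x y point_eq_iff)
  qed
  have "g ` {1..2 * m} \<subseteq> {1..2 * m}"
    using point_in by (auto simp: g_def)
  with inj have "bij_betw g {1..2 * m} {1..2 * m}"
    by (simp add: bij_betw_def endo_inj_surj)
  moreover have "g x = x" if "x \<notin> {1..2 * m}" for x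
    using that by (simp only: g_def if_False)
  ultimately have "g permutes {1..2 * m}"
    by (rule bij_imp_permutes)
  moreover have "acts_by g r f"
    using g by (simp add: acts_by_def)
  ultimately show thesis
    by (rule that)
qed

lemma subgroup_rotation_group: "subgroup rotation_group (sym_group (2 * m))"
proof (rule group.subgroupI[OF sym_group_is_group])
  show "rotation_group \<subseteq> carrier (sym_group (2 * m))"
    by (auto simp: rotation_group_def sym_group_carrier)
  obtain g where "g permutes {1..2 * m}" "acts_by g 0 (\<lambda>_. 0)"
    using acts_by_exists[OF twists_zero] .
  then show "rotation_group \<noteq> {}"
    using twists_zero by (auto simp: rotation_group_def)
next
  fix g assume "g \<in> rotation_group"
  then obtain r f where g: "g permutes {1..2 * m}" and f: "f \<in> twists" and act: "acts_by g r f"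
    by (auto simp: rotation_group_def)
  \<comment> \<open>Going back from block \<open>b\<close> leads to block \<open>b - r\<close>, and
    the twist to undo is the one applied there.\<close>
  have "acts_by (Hilbert_Choice.inv g) (- r) (\<lambda>b. - f (b + (- r)))"
    unfolding acts_by_def
  proof (intro allI)
    fix b e
    have "g (point (b + - r) (e + - f (b + - r))) = point b e"
      using act by (simp add: acts_by_def)
    then show "Hilbert_Choice.inv g (point b e) = point (b + - r) (e + - f (b + - r))"
      using permutes_inverses(2)[OF g] by metis
  qed
  moreover have "(\<lambda>b. - f (b + (- r))) \<in> twists"
    by (intro twists_uminus twists_shift f)
  ultimately show "inv\<^bsub>sym_group (2 * m)\<^esub> g \<in> rotation_group"
    using g by (auto simp: rotation_group_def sym_group_carrier permutes_inv)
next
  fix g h assume "g \<in> rotation_group" "h \<in> rotation_group"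
  then obtain r f s k
    where g: "g permutes {1..2 * m}" "f \<in> twists" "acts_by g r f"
      and h: "h permutes {1..2 * m}" "k \<in> twists" "acts_by h s k"
    by (auto simp: rotation_group_def)
  \<comment> \<open>\<open>h\<close> acts first and moves block \<open>b\<close> to
    \<open>b + s\<close>, where \<open>g\<close> then applies its twist.\<close>
  have "acts_by (g \<circ> h) (s + r) (\<lambda>b. k b + f (b + s))"
    using g(3) h(3) by (simp add: acts_by_def add.assoc)
  moreover have "(\<lambda>b. k b + f (b + s)) \<in> twists"
    by (intro twists_add twists_shift g h)
  moreover have "g \<circ> h permutes {1..2 * m}"
    using h(1) g(1) by (rule permutes_compose)
  ultimately show "g \<otimes>\<^bsub>sym_group (2 * m)\<^esub> h \<in> rotation_group"
    unfolding rotation_group_def sym_group_mult by blast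
qed

text \<open>A rotation carries one block to the other, and a twist with a prescribed value at the
  first block corrects the second coordinate.\<close>

lemma rotation_group_transitive:
  assumes "x \<in> {1..2 * m}" "y \<in> {1..2 * m}"
  shows "\<exists>g\<in>rotation_group. g x = y"
proof -
  obtain b e where x: "x = point b e"
    using assms(1) by (rule pointE)
  obtain b' e' where y: "y = point b' e'"
    using assms(2) by (rule pointE)
  obtain f where f: "f \<in> twists" "f b = e' - e"
    by (rule twists_exists_value)
  obtain g where g: "g permutes {1..2 * m}" "acts_by g (b' - b) f"
    using acts_by_exists[OF f(1)] .
  have "g x = y"
    using g(2) f(2) by (simp add: acts_by_def x y)
  with g f(1) show ?thesis
    unfolding rotation_group_def by blast
qed

text \<open>Block number \<open>c\<close> consists of the points \<open>2 c + 1\<close> and \<open>2 c + 2\<close>, and 1 lies in block 0.\<close>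

definition rotation_part :: "(nat \<Rightarrow> nat) \<Rightarrow> nat" where
  "rotation_part g = (g 1 - 1) div 2"

text \<open>The point 1 has coordinates 0 and 0, so its image lies in block \<open>r\<close> modulo
  \<open>m\<close> whatever the twist is.\<close>

lemma rotation_part_acts_by:
  assumes "acts_by g r f"
  shows "int (rotation_part g) = r mod int m"
proof -
  have "point 0 0 = 1"
    by (simp add: point_def)
  then have "g 1 = point r (f 0)"
    using assms unfolding acts_by_def by (metis add_0)
  moreover have "int ((nat (2 * c + d + 1) - 1) div 2) = c" if "c \<ge> 0" "d \<in> {0..<2}" for c d :: int
  proof -
    have "nat (2 * c + d + 1) - 1 = 2 * nat c + nat d" "nat d < 2"
      using that by auto
    then show ?thesis
      using that(1) by simp
  qed
  ultimately show ?thesis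
    unfolding rotation_part_def point_def using m_pos by simp
qed

section \<open>The derangement graph of the group\<close>

text \<open>The difference of the two twists is a twist and so is even at some block. If the
  rotations coincide modulo \<open>m\<close>, the elements agree on that block; otherwise they agree
  nowhere.\<close>

lemma agree_iff_rotation_part_eq:
  assumes "g \<in> rotation_group" "h \<in> rotation_group"
  shows "(\<exists>x\<in>{1..2 * m}. g x = h x) \<longleftrightarrow> rotation_part g = rotation_part h"
proof -
  obtain r f s k where g: "f \<in> twists" "acts_by g r f" and h: "k \<in> twists" "acts_by h s k"
    using assms by (auto simp: rotation_group_def)
  have "(\<lambda>b. f b + - k b) \<in> twists"
    by (intro twists_add twists_uminus g h)
  then obtain b where b: "even (f b - k b)"
    by (rule twists_even_value) simp
  have "(\<exists>x\<in>{1..2 * m}. g x = h x) \<longleftrightarrow> (\<exists>b e. g (point b e) = h (point b e))"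
    by (metis point_in pointE)
  also have "\<dots> \<longleftrightarrow> r mod int m = s mod int m"
    using b by (auto simp: acts_by_eq_iff[OF g(2) h(2)])
  also have "\<dots> \<longleftrightarrow> rotation_part g = rotation_part h"
    by (metis rotation_part_acts_by g(2) h(2) of_nat_eq_iff)
  finally show ?thesis .
qed

lemma rotation_part_image: "rotation_part ` rotation_group = {..<m}"
proof (intro subset_antisym subsetI)
  fix c assume "c \<in> rotation_part ` rotation_group"
  then obtain g r f where "c = rotation_part g" "acts_by g r f"
    by (auto simp: rotation_group_def)
  then have "int c < int m"
    using rotation_part_acts_by m_pos by simp
  then show "c \<in> {..<m}"
    by simp
next
  fix c assume "c \<in> {..<m}"
  \<comment> \<open>By transitivity 1 can be moved to \<open>2 * c + 1\<close>, the first point of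
    block \<open>c\<close>.\<close>
  then obtain g where "g \<in> rotation_group" "g 1 = 2 * c + 1"
    using rotation_group_transitive[of 1 "2 * c + 1"] by auto
  then show "c \<in> rotation_part ` rotation_group"
    by (auto simp: rotation_part_def intro!: rev_image_eqI[of g])
qed

lemma transitive_rotation_group: "transitive_perm_group (2 * m) rotation_group"
  unfolding transitive_perm_group_iff
  using subgroup_rotation_group rotation_group_transitive by blast

lemma complete_multipartite_rotation_group:
  "complete_multipartite_digraph m (with_proj (derangement_graph (2 * m) rotation_group))"
proof -
  have "complete_multipartite_digraph (card (rotation_part ` rotation_group))
    (with_proj (derangement_graph (2 * m) rotation_group))"
    by (rule complete_multipartite_derangement_graphI)
      (use agree_iff_rotation_part_eq in \<open>auto simp: rotation_group_def\<close>)
  then show ?thesis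
    by (simp add: rotation_part_image)
qed

end

theorem theorem3p4:
  fixes n :: nat
  assumes "n > 0" and "even n" and "\<not> (\<exists>k. n = 2 ^ k)"
  shows "\<exists>G. transitive_perm_group n G \<and>
             complete_multipartite_digraph (n div 2) (with_proj (derangement_graph n G))"
proof -
  obtain m where n: "n = 2 * m"
    using assms(2) by blast
  \<comment> \<open>\<open>q\<close> is the odd part of \<open>n\<close>; it differs from 1 because
    \<open>n\<close> is not a power of 2, and being coprime to 2 it divides
    \<open>m\<close>.\<close>
  obtain q where q: "n = 2 ^ multiplicity 2 n * q" "\<not> 2 dvd q"
    using multiplicity_decompose'[of n 2] assms(1) by auto
  have "q \<noteq> 1"
    using q(1) assms(3) by (metis mult.right_neutral)
  moreover have "q \<noteq> 0"
    using q(2) by (intro notI) simp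
  moreover have "q dvd 2 * m"
    using q(1) n by (metis dvd_triv_right)
  then have "q dvd m"
    using q(2) by (simp add: coprime_dvd_mult_right_iff)
  ultimately interpret twisted_rotations m q
    using assms(1) n q(2) by unfold_locales auto
  show ?thesis
    using transitive_rotation_group complete_multipartite_rotation_group n by auto
qed

end
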